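(* Let $G$ be a finite connected graph that admits a perfect matching. Then $\eta(G)=1$ if and only if every maximal matching of $G$ is a perfect matching.
   Context: For a graph $G=(V,E)$ admitting a perfect matching, a weight function is a map $w:E\to\mathbb{R}_{\ge 0}$ that is not identically zero (zero weights are allowed, but at least one edge has positive weight). For $E'\subseteq E$ let $w(E')=\sum_{e\in E'}w(e)$. Let $M^*(G)$ denote a matching of $G$ of maximum weight and $P^*(G)$ a perfect matching of $G$ of maximum weight among all perfect matchings. Define $\eta(G)=\min_{w} \frac{w(P^*(G))}{w(M^*(G))}$, the minimum over all such weight functions $w$. A matching is maximal if it is not contained in any larger matching; it is perfect if it has $|V|/2$ edges. *)

theory Defs
  imports "HOL-Analysis.Analysis"
begin

(* Finite simple graphs: a vertex set V and a set E of two-element subsets of V. *)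
definition fin_graph :: "'a set \<Rightarrow> 'a set set \<Rightarrow> bool" where
  "fin_graph V E \<longleftrightarrow> finite V \<and> (\<forall>e\<in>E. e \<subseteq> V \<and> card e = 2)"

definition connected_graph :: "'a set \<Rightarrow> 'a set set \<Rightarrow> bool" where
  "connected_graph V E \<longleftrightarrow> V \<noteq> {} \<and> (\<forall>u\<in>V. \<forall>v\<in>V. (u, v) \<in> {(x, y). {x, y} \<in> E}\<^sup>*)"

definition matching :: "'a set set \<Rightarrow> 'a set set \<Rightarrow> bool" where
  "matching E M \<longleftrightarrow> M \<subseteq> E \<and> pairwise disjnt M"

definition maximal_matching :: "'a set set \<Rightarrow> 'a set set \<Rightarrow> bool" where
  "maximal_matching E M \<longleftrightarrow> matching E M \<and> \<not> (\<exists>M'. matching E M' \<and> M \<subset> M')"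

definition perfect_matching :: "'a set \<Rightarrow> 'a set set \<Rightarrow> 'a set set \<Rightarrow> bool" where
  "perfect_matching V E M \<longleftrightarrow> matching E M \<and> 2 * card M = card V"

(* Only the values of w on E are relevant, here and below. *)
definition weight_function :: "'a set set \<Rightarrow> ('a set \<Rightarrow> real) \<Rightarrow> bool" where
  "weight_function E w \<longleftrightarrow> (\<forall>e\<in>E. 0 \<le> w e) \<and> (\<exists>e\<in>E. w e \<noteq> 0)"

definition max_weight_matching :: "'a set set \<Rightarrow> ('a set \<Rightarrow> real) \<Rightarrow> 'a set set" where
  "max_weight_matching E w = (ARG_MAX (sum w) M. matching E M)"

definition max_weight_perfect_matching ::
    "'a set \<Rightarrow> 'a set set \<Rightarrow> ('a set \<Rightarrow> real) \<Rightarrow> 'a set set" where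
  "max_weight_perfect_matching V E w = (ARG_MAX (sum w) M. perfect_matching V E M)"

definition weight_ratio :: "'a set \<Rightarrow> 'a set set \<Rightarrow> ('a set \<Rightarrow> real) \<Rightarrow> real" where
  "weight_ratio V E w =
     sum w (max_weight_perfect_matching V E w) / sum w (max_weight_matching E w)"

(* LEAST is the minimum whenever one exists; lemma eta_is_minimum below shows that it does
   exist for every finite graph with an edge and a perfect matching. *)
definition eta :: "'a set \<Rightarrow> 'a set set \<Rightarrow> real" where
  "eta V E = (LEAST r. \<exists>w. weight_function E w \<and> r = weight_ratio V E w)"

lemma fin_graph_finite_edges: "fin_graph V E \<Longrightarrow> finite E"
  by (metis PowI finite_Pow_iff finite_subset fin_graph_def subsetI)

lemma sum_arg_max_eq_Max:
  fixes f :: "'b \<Rightarrow> real"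
  assumes "finite {x. P x}" "\<exists>x. P x"
  shows "f (ARG_MAX f x. P x) = Max (f ` {x. P x})" "P (ARG_MAX f x. P x)"
proof -
  let ?m = "Max (f ` {x. P x})"
  have "?m \<in> f ` {x. P x}" using assms by (intro Max_in) auto
  then obtain x where x: "P x" "f x = ?m" by auto
  have le: "f y \<le> ?m" if "P y" for y using that assms by (intro Max_ge) auto
  have "is_arg_max f P x" using x le by (fastforce simp: is_arg_max_def not_less)
  then have a: "is_arg_max f P (ARG_MAX f x. P x)"
    unfolding arg_max_def by (rule someI)
  then show "P (ARG_MAX f x. P x)" by (simp add: is_arg_max_def)
  then have "f (ARG_MAX f x. P x) \<le> ?m" by (rule le)
  moreover have "\<not> f x > f (ARG_MAX f x. P x)" using a x by (auto simp: is_arg_max_def)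
  ultimately show "f (ARG_MAX f x. P x) = ?m" using x by simp
qed

lemma continuous_on_Max_image:
  fixes f :: "'b \<Rightarrow> 'c::topological_space \<Rightarrow> real"
  assumes "finite A" "A \<noteq> {}" "\<And>a. a \<in> A \<Longrightarrow> continuous_on K (f a)"
  shows "continuous_on K (\<lambda>w. Max ((\<lambda>a. f a w) ` A))"
  using assms
proof (induction A rule: finite_ne_induct)
  case (singleton a)
  then show ?case by simp
next
  case (insert a A)
  then have "continuous_on K (\<lambda>w. max (f a w) (Max ((\<lambda>a. f a w) ` A)))"
    by (intro continuous_on_max) auto
  then show ?case using insert by simp
qed

lemma eta_is_minimum:
  assumes G: "fin_graph V E" and ne: "E \<noteq> {}" and pm: "\<exists>M. perfect_matching V E M"
  shows "\<exists>w. weight_function E w \<and> eta V E = weight_ratio V E w"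
    and "\<And>w. weight_function E w \<Longrightarrow> eta V E \<le> weight_ratio V E w"
proof -
  let ?MM = "{M. matching E M}" and ?PM = "{M. perfect_matching V E M}"
  have finE: "finite E" using G by (rule fin_graph_finite_edges)
  have finM: "finite ?MM"
    by (rule finite_subset[of _ "Pow E"]) (auto simp: matching_def finE)
  have finP: "finite ?PM"
    by (rule finite_subset[OF _ finM]) (auto simp: perfect_matching_def)
  have exM: "\<exists>M. matching E M" using pm by (auto simp: perfect_matching_def)
  have ratio: "weight_ratio V E w = Max (sum w ` ?PM) / Max (sum w ` ?MM)" for w
    unfolding weight_ratio_def max_weight_matching_def max_weight_perfect_matching_def
    using sum_arg_max_eq_Max(1)[OF finP pm] sum_arg_max_eq_Max(1)[OF finM exM] by simp
  have subP: "M \<subseteq> E" if "M \<in> ?PM" for M using that by (auto simp: perfect_matching_def matching_def)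
  have subM: "M \<subseteq> E" if "M \<in> ?MM" for M using that by (auto simp: matching_def)
  define K where "K = (PiE UNIV (\<lambda>e. if e \<in> E then {0..1::real} else {0})) \<inter> {w. sum w E = 1}"
  have cc: "continuous_on S (\<lambda>w::'a set \<Rightarrow> real. sum w M)" for M S
    by (intro continuous_intros continuous_on_product_coordinates
        continuous_on_subset[OF continuous_on_product_coordinates]) auto
  have K1: "compact (PiE UNIV (\<lambda>e. if e \<in> E then {0..1::real} else {0}))"
    using compactin_PiE[of "\<lambda>_. euclidean" UNIV "\<lambda>e. if e \<in> E then {0..1::real} else {0}"]
    by (auto simp: euclidean_product_topology)
  have K2: "closed {w::'a set \<Rightarrow> real. sum w E = 1}"
    by (intro closed_Collect_eq cc continuous_on_const)
  have compK: "compact K" unfolding K_def using K1 K2 by (rule compact_Int_closed)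
  have wfK: "weight_function E w" if "w \<in> K" for w
  proof -
    have "0 \<le> w e" if "e \<in> E" for e
      using \<open>w \<in> K\<close> that unfolding K_def PiE_def Pi_def by (auto dest!: spec[of _ e])
    moreover have "\<exists>e\<in>E. w e \<noteq> 0"
    proof (rule ccontr)
      assume "\<not> (\<exists>e\<in>E. w e \<noteq> 0)"
      then have "sum w E = 0" by simp
      then show False using \<open>w \<in> K\<close> by (simp add: K_def)
    qed
    ultimately show ?thesis by (auto simp: weight_function_def)
  qed
  have pos: "Max (sum w ` ?MM) > 0" if w: "weight_function E w" for w
  proof -
    obtain e where e: "e \<in> E" "w e > 0"
      using w by (force simp: weight_function_def)
    then have "matching E {e}" by (auto simp: matching_def)
    then have "sum w {e} \<le> Max (sum w ` ?MM)" using finM by (intro Max_ge finite_imageI imageI) auto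
    then show ?thesis using e by simp
  qed
  have contK: "continuous_on K (weight_ratio V E)"
    unfolding ratio[abs_def]
  proof (intro continuous_on_divide ballI)
    show "continuous_on K (\<lambda>w. Max (sum w ` ?PM))"
      using continuous_on_Max_image[OF finP, of K "\<lambda>M w. sum w M"] cc pm by auto
    show "continuous_on K (\<lambda>w. Max (sum w ` ?MM))"
      using continuous_on_Max_image[OF finM, of K "\<lambda>M w. sum w M"] cc exM by auto
    show "Max (sum w ` ?MM) \<noteq> 0" if "w \<in> K" for w
      using pos[OF wfK[OF that]] by simp
  qed
  have norm: "\<exists>w'\<in>K. weight_ratio V E w' = weight_ratio V E w" if w: "weight_function E w" for w
  proof -
    define S where "S = sum w E"
    have nn: "\<And>e. e \<in> E \<Longrightarrow> 0 \<le> w e" using w by (auto simp: weight_function_def)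
    have "S \<noteq> 0" using w finE nn by (auto simp: S_def sum_nonneg_eq_0_iff weight_function_def)
    moreover have "0 \<le> S" unfolding S_def by (intro sum_nonneg nn)
    ultimately have S: "S > 0" by simp
    define w' where "w' = (\<lambda>e. if e \<in> E then w e / S else 0)"
    have le: "w e \<le> S" if "e \<in> E" for e
      unfolding S_def using finE nn that by (intro member_le_sum) auto
    have sw: "sum w' M = sum w M / S" if "M \<subseteq> E" for M
      unfolding sum_divide_distrib using that by (intro sum.cong) (auto simp: w'_def)
    have "w' \<in> K" unfolding K_def
      using S nn le sw[of E] by (auto simp: w'_def S_def[symmetric])
    moreover have scale: "Max (sum w' ` A) = Max (sum w ` A) / S"
      if "finite A" "A \<noteq> {}" "\<And>M. M \<in> A \<Longrightarrow> M \<subseteq> E" for A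
    proof -
      have "sum w' ` A = (\<lambda>x. x / S) ` sum w ` A" using sw that(3) by (auto simp: image_image)
      moreover have "mono (\<lambda>x. x / S)" using S by (auto simp: mono_def divide_right_mono)
      ultimately show ?thesis
        using mono_Max_commute[of "\<lambda>x. x / S" "sum w ` A"] that by simp
    qed
    have "weight_ratio V E w' = weight_ratio V E w"
      unfolding ratio using scale[OF finP _ subP] scale[OF finM _ subM] pm exM S by simp
    ultimately show ?thesis by blast
  qed
  obtain e where "e \<in> E" using ne by blast
  then have "weight_function E (\<lambda>_. 1)" by (auto simp: weight_function_def)
  then have "K \<noteq> {}" using norm by blast
  then obtain w0 where w0: "w0 \<in> K" "\<And>w. w \<in> K \<Longrightarrow> weight_ratio V E w0 \<le> weight_ratio V E w"
    using continuous_attains_inf[OF compK _ contK] by blast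
  have min: "weight_ratio V E w0 \<le> weight_ratio V E w" if "weight_function E w" for w
    using norm[OF that] w0(2) by metis
  have eq: "eta V E = weight_ratio V E w0"
    unfolding eta_def using min wfK[OF w0(1)] by (intro Least_equality) auto
  show "\<exists>w. weight_function E w \<and> eta V E = weight_ratio V E w" using eq wfK[OF w0(1)] by blast
  show "\<And>w. weight_function E w \<Longrightarrow> eta V E \<le> weight_ratio V E w" using eq min by simp
qed

end

theory Submission
  imports Defs
begin

text \<open>If every maximal matching is perfect, then a maximum weight matching extends to a perfect one
  of at least the same weight, so every ratio is 1. Conversely, if the minimum ratio is 1, take as
  weight the indicator function of a maximal matching \<open>M\<close>: a perfect matching of weight at least
  \<open>card M\<close> must contain \<open>M\<close>, hence equals \<open>M\<close> by maximality.\<close>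

lemma finite_matchings:
  assumes "finite E"
  shows "finite {M. matching E M}"
  by (rule finite_subset[of _ "Pow E"]) (auto simp: matching_def assms)

lemma matching_empty: "matching E {}"
  by (simp add: matching_def)

lemma matching_singleton: "e \<in> E \<Longrightarrow> matching E {e}"
  by (simp add: matching_def)

text \<open>\<open>ARG_MAX\<close> is a choice operator, meaningful only if the maximum is attained;
  this holds since a finite edge set has finitely many matchings, among them
  \<open>{}\<close>.\<close>

lemma max_weight_matching:
  assumes "finite E"
  shows "matching E (max_weight_matching E w)"
    and "matching E M \<Longrightarrow> sum w M \<le> sum w (max_weight_matching E w)"
proof -
  have ex: "\<exists>M. matching E M" using matching_empty by blast
  show "matching E (max_weight_matching E w)"
    unfolding max_weight_matching_def
    by (rule sum_arg_max_eq_Max(2)[OF finite_matchings[OF assms] ex])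
  show "sum w M \<le> sum w (max_weight_matching E w)" if "matching E M"
    unfolding max_weight_matching_def sum_arg_max_eq_Max(1)[OF finite_matchings[OF assms] ex]
    using that finite_matchings[OF assms] by (intro Max_ge) auto
qed

lemma max_weight_perfect_matching:
  assumes "finite E" and ex: "\<exists>M. perfect_matching V E M"
  shows "perfect_matching V E (max_weight_perfect_matching V E w)"
    and "perfect_matching V E M \<Longrightarrow> sum w M \<le> sum w (max_weight_perfect_matching V E w)"
proof -
  have fin: "finite {M. perfect_matching V E M}"
    by (rule finite_subset[OF _ finite_matchings[OF assms(1)]]) (auto simp: perfect_matching_def)
  show "perfect_matching V E (max_weight_perfect_matching V E w)"
    unfolding max_weight_perfect_matching_def by (rule sum_arg_max_eq_Max(2)[OF fin ex])
  show "sum w M \<le> sum w (max_weight_perfect_matching V E w)" if "perfect_matching V E M"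
    unfolding max_weight_perfect_matching_def sum_arg_max_eq_Max(1)[OF fin ex]
    using that fin by (intro Max_ge) auto
qed

lemma matching_extends_to_maximal:
  assumes "finite E" and "matching E M"
  shows "\<exists>N. maximal_matching E N \<and> M \<subseteq> N"
  using finite_has_maximal2[OF finite_matchings[OF assms(1)], of M] assms(2)
  unfolding maximal_matching_def by (metis mem_Collect_eq psubset_eq)

text \<open>A single edge of positive weight is already a matching. This keeps the denominator of
  \<open>weight_ratio\<close> away from 0, so it can be cleared or cancelled.\<close>

lemma max_weight_matching_pos:
  assumes "finite E" and w: "weight_function E w"
  shows "0 < sum w (max_weight_matching E w)"
proof -
  obtain e where e: "e \<in> E" "0 < w e"
    using w by (force simp: weight_function_def)
  then show ?thesis
    using max_weight_matching(2)[OF assms(1) matching_singleton[OF e(1)], of w] by simp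
qed

theorem theorem2p1:
  fixes V :: "'a set" and E :: "'a set set"
  assumes "fin_graph V E"
    and "connected_graph V E"
    and "\<exists>M. perfect_matching V E M"
  shows "eta V E = 1 \<longleftrightarrow> (\<forall>M. maximal_matching E M \<longrightarrow> perfect_matching V E M)"
proof -
  have fin: "finite E" using assms(1) by (rule fin_graph_finite_edges)
  \<comment> \<open>Connectedness supplies a vertex, so a perfect matching has an edge;
    \<open>eta_is_minimum\<close> requires \<open>E\<close> to be nonempty.\<close>
  have "card V \<noteq> 0" using assms(1,2) by (auto simp: fin_graph_def connected_graph_def)
  then have ne: "E \<noteq> {}"
    using assms(3) by (auto simp: perfect_matching_def matching_def)
  note PM = max_weight_perfect_matching[OF fin assms(3)]
  note MM = max_weight_matching[OF fin]
  show ?thesis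
  proof (intro iffI allI impI)
    fix M assume eta: "eta V E = 1" and max: "maximal_matching E M"
    have M: "matching E M" using max by (simp add: maximal_matching_def)
    \<comment> \<open>Any single edge would properly extend the empty matching. Without this the
      indicator of \<open>M\<close> would be identically zero.\<close>
    have "M \<noteq> {}"
      using max ne matching_singleton unfolding maximal_matching_def by blast
    define w :: "'a set \<Rightarrow> real" where "w = indicator M"
    have w: "weight_function E w"
      using \<open>M \<noteq> {}\<close> M by (auto simp: weight_function_def w_def indicator_def matching_def)
    define P where "P = max_weight_perfect_matching V E w"
    have P: "perfect_matching V E P" unfolding P_def by (rule PM(1))
    have finP: "finite P" and finM: "finite M"
      using P M fin by (auto simp: perfect_matching_def matching_def intro: finite_subset)
    have "1 \<le> weight_ratio V E w"
      using eta_is_minimum(2)[OF assms(1) ne assms(3) w] eta by simp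
    then have "sum w (max_weight_matching E w) \<le> sum w P"
      using max_weight_matching_pos[OF fin w] by (simp add: weight_ratio_def P_def)
    with MM(2)[OF M, of w] have "sum w M \<le> sum w P" by linarith
    \<comment> \<open>Indicator weights count the edges in \<open>M\<close>, which turns the weight
      inequality into one between cardinalities.\<close>
    moreover have "sum w A = card (A \<inter> M)" if "finite A" for A
      using that by (simp add: w_def indicator_def[abs_def] of_bool_def sum.If_cases)
    ultimately have "card M \<le> card (P \<inter> M)"
      using finP finM by simp
    then have "M \<subseteq> P"
      using card_seteq[of M "P \<inter> M"] finM by blast
    then have "M = P"
      using P max by (auto simp: maximal_matching_def perfect_matching_def)
    then show "perfect_matching V E M" using P by simp
  next
    assume all: "\<forall>M. maximal_matching E M \<longrightarrow> perfect_matching V E M"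
    \<comment> \<open>As the minimum is attained, it suffices to show that the ratio is 1 at one
      minimizing \<open>w\<close>.\<close>
    obtain w where w: "weight_function E w" and eta: "eta V E = weight_ratio V E w"
      using eta_is_minimum(1)[OF assms(1) ne assms(3)] by blast
    define M where "M = max_weight_matching E w"
    obtain N where N: "maximal_matching E N" "M \<subseteq> N"
      using matching_extends_to_maximal[OF fin MM(1)] unfolding M_def by blast
    have "N \<subseteq> E" using N(1) by (simp add: maximal_matching_def matching_def)
    \<comment> \<open>Weights are nonnegative, so adding edges loses none.\<close>
    then have "sum w M \<le> sum w N"
      using w fin N(2) by (intro sum_mono2) (auto simp: weight_function_def intro: finite_subset)
    also have "\<dots> \<le> sum w (max_weight_perfect_matching V E w)"
      using all N(1) by (intro PM(2)) simp
    \<comment> \<open>The reverse inequality holds because a perfect matching is a matching.\<close>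
    finally have "sum w (max_weight_perfect_matching V E w) = sum w M"
      using MM(2)[of "max_weight_perfect_matching V E w" w] PM(1)[of w]
      by (simp add: M_def perfect_matching_def)
    then show "eta V E = 1"
      using max_weight_matching_pos[OF fin w] by (simp add: eta weight_ratio_def M_def)
  qed
qed

end
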